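(* Let $f:[0,1]\to[0,1]$ be a continuous function, let $\{\theta_n\}_{n\ge 0}$ be a sequence of real numbers in $[0,1]$, and let $\{r_n\}_{n\ge 0}$ be a sequence of real numbers. Let $\{x_n\}_{n\ge 0}$ be a sequence of real numbers in $[0,1]$ satisfying, for every $n\ge 0$, $$x_{n+1}=(1-\theta_n)x_n+\theta_n f(x_n)+r_n .$$ Assume that (1) $\theta_n\to 0$ as $n\to\infty$; (2) the series $\sum_{n=0}^{\infty}\theta_n$ diverges; (3) $\theta_n\neq 0$ for all sufficiently large $n$, and $\frac{r_n}{\theta_n}\to 0$ as $n\to\infty$; (4) the series $\sum_{n=0}^{\infty} r_n$ converges. Then the sequence $\{x_n\}$ converges to a fixed point of $f$, i.e. there is $x_\infty\in[0,1]$ with $f(x_\infty)=x_\infty$ and $\lim_{n\to\infty}x_n=x_\infty$.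
   Context: Convergence of the series $\sum r_n$ means convergence of its partial sums (not necessarily absolute convergence). *)

theory Defs
  imports "HOL-Analysis.Analysis"
begin

end

theory Submission
  imports Defs
begin

text \<open>
  Adding the tails of the series \<open>r\<close> turns \<open>x\<close> into a sequence \<open>y\<close> whose increments are
  \<open>\<theta> n * (f (x n) - x n)\<close>, and \<open>y - x\<close> tends to 0. If \<open>x\<close> oscillated across an interval, then
  on some subinterval \<open>f - id\<close> would have constant sign, so \<open>y\<close> would be monotone whenever \<open>x\<close>
  is there; as the increments tend to 0, the subinterval cannot be jumped over and could be
  crossed in one direction only. Hence \<open>x\<close> converges, and at a limit that is not fixed the
  increments of the convergent sequence \<open>y\<close> would dominate a multiple of \<open>\<theta>\<close>.
\<close>

text \<open>Lower and upper limits are taken in the extended reals, where they always exist. For a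
  bounded sequence they can coincide only if it converges, so otherwise \<open>p\<close> and
  \<open>q\<close> fit strictly between them.\<close>

lemma bounded_not_convergent_oscillates:
  fixes x :: "nat \<Rightarrow> real"
  assumes "Bseq x" "\<not> convergent x"
  obtains p q where "p < q" "\<exists>\<^sub>F n in sequentially. x n < p" "\<exists>\<^sub>F n in sequentially. q < x n"
proof -
  let ?X = "\<lambda>n. ereal (x n)"
  obtain K where K: "\<And>n. \<bar>x n\<bar> \<le> K"
    using assms(1) by (auto simp: Bseq_def)
  have "liminf ?X \<noteq> limsup ?X"
  proof
    assume eq: "liminf ?X = limsup ?X"
    have lim: "?X \<longlonglongrightarrow> limsup ?X"
      using eq by (simp add: tendsto_iff_Liminf_eq_Limsup)
    \<comment> \<open>These bounds rule out an infinite common value, so the limit is a real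
      number.\<close>
    have "limsup ?X \<le> ereal K" "ereal (- K) \<le> liminf ?X"
      using K by (auto intro!: Limsup_bounded Liminf_bounded always_eventually simp: abs_le_iff minus_le_iff)
    with eq obtain l where "limsup ?X = ereal l"
      by (cases "limsup ?X") auto
    with lim have "x \<longlonglongrightarrow> l" by simp
    with assms(2) show False by (auto simp: convergent_def)
  qed
  then have "liminf ?X < limsup ?X"
    using Liminf_le_Limsup[of sequentially ?X] by (simp add: less_le)
  then obtain p where p: "liminf ?X < ereal p" "ereal p < limsup ?X"
    using ereal_dense2 by blast
  obtain q where q: "ereal p < ereal q" "ereal q < limsup ?X"
    using ereal_dense2 p(2) by blast
  have "\<exists>\<^sub>F n in sequentially. x n < p"
  proof (rule ccontr)
    assume "\<not> ?thesis"
    then have "ereal p \<le> liminf ?X"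
      by (intro Liminf_bounded) (simp add: not_frequently not_less)
    with p(1) show False by simp
  qed
  moreover have "\<exists>\<^sub>F n in sequentially. q < x n"
  proof (rule ccontr)
    assume "\<not> ?thesis"
    then have "limsup ?X \<le> ereal q"
      by (intro Limsup_bounded) (simp add: not_frequently not_less)
    with q(2) show False by simp
  qed
  ultimately show thesis using that q(1) by simp
qed

text \<open>Start from a late index with \<open>y\<close> above \<open>b\<close>. From above
  \<open>b\<close>, a step shorter than \<open>b - a\<close> cannot land below \<open>a\<close>;
  from inside the interval, \<open>y\<close> does not decrease. So \<open>a \<le> y n\<close> is
  preserved forever.\<close>

lemma no_downcrossing:
  fixes y :: "nat \<Rightarrow> real"
  assumes "a < b"
    and steps: "(\<lambda>n. y (Suc n) - y n) \<longlonglongrightarrow> 0"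
    and up: "\<forall>\<^sub>F n in sequentially. y n \<in> {a..b} \<longrightarrow> y n \<le> y (Suc n)"
    and freq: "\<exists>\<^sub>F n in sequentially. b < y n"
  shows "\<forall>\<^sub>F n in sequentially. a \<le> y n"
proof -
  have "\<forall>\<^sub>F n in sequentially. \<bar>y (Suc n) - y n\<bar> < b - a"
    using steps \<open>a < b\<close> by (auto dest: tendstoD[where e = "b - a"] simp: dist_real_def)
  from eventually_conj[OF this up] obtain N where N: "\<And>n. n \<ge> N \<Longrightarrow> \<bar>y (Suc n) - y n\<bar> < b - a"
      "\<And>n. n \<ge> N \<Longrightarrow> y n \<in> {a..b} \<Longrightarrow> y n \<le> y (Suc n)"
    unfolding eventually_sequentially by blast
  obtain n0 where n0: "n0 \<ge> N" "b < y n0"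
    using freq by (auto simp: frequently_sequentially)
  have "a \<le> y n" if "n \<ge> n0" for n
    using that
  proof (induction n rule: dec_induct)
    case base
    then show ?case using n0(2) \<open>a < b\<close> by simp
  next
    case (step n)
    show ?case
    proof (cases "y n \<le> b")
      case True
      then show ?thesis using N(2)[of n] step n0(1) by simp
    next
      case False
      then show ?thesis using N(1)[of n] step n0(1) by simp
    qed
  qed
  then show ?thesis by (auto simp: eventually_sequentially)
qed

text \<open>Monotonicity is known by the position of \<open>x\<close>, but the crossing argument
  runs on \<open>y\<close>. With \<open>y\<close> within \<open>e\<close> of \<open>x\<close>, a
  third of the interval, \<open>y\<close> in the middle third forces \<open>x\<close> into
  \<open>{p..q}\<close>. The outer thirds absorb the error when \<open>low\<close> and
  \<open>high\<close> are compared with bounds on \<open>y\<close>.\<close>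

lemma no_oscillation:
  fixes x y :: "nat \<Rightarrow> real"
  assumes "p < q"
    and close: "(\<lambda>n. y n - x n) \<longlonglongrightarrow> 0"
    and steps: "(\<lambda>n. y (Suc n) - y n) \<longlonglongrightarrow> 0"
    and up: "\<And>n. x n \<in> {p..q} \<Longrightarrow> y n \<le> y (Suc n)"
    and low: "\<exists>\<^sub>F n in sequentially. x n < p"
    and high: "\<exists>\<^sub>F n in sequentially. q < x n"
  shows False
proof -
  define e where "e = (q - p) / 3"
  have "e > 0" and q: "q = p + 3 * e" using \<open>p < q\<close> by (simp_all add: e_def field_simps)
  have near: "\<forall>\<^sub>F n in sequentially. \<bar>y n - x n\<bar> < e"
    using tendstoD[OF close \<open>e > 0\<close>] by (simp add: dist_real_def)
  have "\<forall>\<^sub>F n in sequentially. p + e \<le> y n"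
  proof (rule no_downcrossing[OF _ steps])
    show "p + e < p + 2 * e" using \<open>e > 0\<close> by simp
    show "\<forall>\<^sub>F n in sequentially. y n \<in> {p + e..p + 2 * e} \<longrightarrow> y n \<le> y (Suc n)"
      using near by eventually_elim (auto intro!: up simp: q)
    show "\<exists>\<^sub>F n in sequentially. p + 2 * e < y n"
      using frequently_eventually_frequently[OF high near]
      by (rule frequently_elim1) (auto simp: q)
  qed
  with near have "\<forall>\<^sub>F n in sequentially. \<not> x n < p"
    by eventually_elim auto
  with low show False by (simp add: frequently_def)
qed

lemma continuous_constant_sign_subinterval:
  fixes g :: "real \<Rightarrow> real"
  assumes "p < q" and cont: "continuous_on {p..q} g"
  obtains a b where "p \<le> a" "a < b" "b \<le> q"
    "(\<forall>t\<in>{a..b}. 0 \<le> g t) \<or> (\<forall>t\<in>{a..b}. g t \<le> 0)"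
proof (cases "\<exists>c\<in>{p<..<q}. g c \<noteq> 0")
  case False
  \<comment> \<open>Here \<open>g\<close> vanishes on the open interval only, so the middle third is
    taken to stay away from the endpoints.\<close>
  show thesis
    by (rule that[of "p + (q - p) / 3" "p + 2 * (q - p) / 3"])
      (use False \<open>p < q\<close> in \<open>auto simp: field_simps\<close>)
next
  case True
  then obtain c where c: "c \<in> {p<..<q}" "g c \<noteq> 0" by blast
  \<comment> \<open>A deviation smaller than the absolute value of \<open>g c\<close> cannot change
    the sign of \<open>g\<close>.\<close>
  then obtain d where d: "d > 0" "\<And>t. t \<in> {p..q} \<Longrightarrow> \<bar>t - c\<bar> < d \<Longrightarrow> \<bar>g t - g c\<bar> < \<bar>g c\<bar>"
    using cont[unfolded continuous_on_iff, rule_format, of c "\<bar>g c\<bar>"]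
    by (auto simp: dist_real_def)
  \<comment> \<open>Halving \<open>d\<close> keeps the closed interval \<open>{c..b}\<close>
    strictly within distance \<open>d\<close> of \<open>c\<close>.\<close>
  define b where "b = min q (c + d / 2)"
  have "\<bar>g t - g c\<bar> < \<bar>g c\<bar>" if "t \<in> {c..b}" for t
    using that c(1) d(1) by (intro d(2)) (auto simp: b_def)
  then have "if g c > 0 then 0 \<le> g t else g t \<le> 0" if "t \<in> {c..b}" for t
    using that by (smt (verit))
  then have "(\<forall>t\<in>{c..b}. 0 \<le> g t) \<or> (\<forall>t\<in>{c..b}. g t \<le> 0)"
    by (cases "g c > 0") simp_all
  then show thesis
    using that[of c b] c d(1) by (simp add: b_def)
qed

text \<open>The increments of a convergent sequence form a convergent telescoping series, and
  comparison passes this on to \<open>\<theta>\<close>. This is what will contradict the divergence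
  of the series of \<open>\<theta>\<close>.\<close>

lemma summable_if_dominated_by_increments:
  fixes \<theta> y :: "nat \<Rightarrow> real"
  assumes "\<And>n. 0 \<le> \<theta> n" "convergent y" "0 < \<delta>"
    and "\<forall>\<^sub>F n in sequentially. \<delta> * \<theta> n \<le> y (Suc n) - y n"
  shows "summable \<theta>"
proof -
  obtain l where "y \<longlonglongrightarrow> l" using assms(2) by (auto simp: convergent_def)
  then have "summable (\<lambda>n. y (Suc n) - y n)"
    using telescope_summable by blast
  then have "summable (\<lambda>n. \<delta> * \<theta> n)"
    by (rule summable_comparison_test_ev[rotated])
      (use assms(1,3,4) in \<open>auto elim: eventually_mono\<close>)
  then show ?thesis using \<open>0 < \<delta>\<close> by simp
qed

theorem theorem1p3:
  fixes f :: "real \<Rightarrow> real" and \<theta> r x :: "nat \<Rightarrow> real"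
  assumes f_cont: "continuous_on {0..1} f"
    and f_into: "f \<in> {0..1} \<rightarrow> {0..1}"
    and theta_range: "\<And>n. \<theta> n \<in> {0..1}"
    and x_range: "\<And>n. x n \<in> {0..1}"
    and x_rec: "\<And>n. x (Suc n) = (1 - \<theta> n) * x n + \<theta> n * f (x n) + r n"
    and theta_lim: "\<theta> \<longlonglongrightarrow> 0"
    and theta_div: "\<not> summable \<theta>"
    and theta_nonzero: "\<forall>\<^sub>F n in sequentially. \<theta> n \<noteq> 0"
    and ratio_lim: "(\<lambda>n. r n / \<theta> n) \<longlonglongrightarrow> 0"
    and r_conv: "summable r"
  shows "\<exists>x_inf\<in>{0..1}. f x_inf = x_inf \<and> x \<longlonglongrightarrow> x_inf"
proof -
  define g where "g t = f t - t" for t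
  \<comment> \<open>The correction is the tail of the series from index \<open>n\<close> on: it
    cancels \<open>r n\<close> in each increment and tends to 0, so \<open>y\<close> has the same
    limiting behaviour as \<open>x\<close>.\<close>
  define y where "y n = x n - (\<Sum>k<n. r k) + suminf r" for n
  have g_cont: "continuous_on {0..1} g"
    unfolding g_def by (intro continuous_intros f_cont)
  have g_bound: "\<bar>g (x n)\<bar> \<le> 1" for n
    using x_range[of n] funcset_mem[OF f_into x_range[of n]] by (auto simp: g_def)
  have theta_nonneg: "0 \<le> \<theta> n" for n using theta_range[of n] by simp
  have y_step: "y (Suc n) - y n = \<theta> n * g (x n)" for n
    unfolding y_def g_def by (simp add: x_rec algebra_simps)
  have steps: "(\<lambda>n. y (Suc n) - y n) \<longlonglongrightarrow> 0"
  proof (rule Lim_null_comparison[OF _ theta_lim], rule always_eventually, rule allI)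
    fix n show "norm (y (Suc n) - y n) \<le> \<theta> n"
      using mult_left_mono[OF g_bound[of n] theta_nonneg[of n]] theta_nonneg[of n]
      by (simp add: y_step abs_mult)
  qed
  have close: "(\<lambda>n. y n - x n) \<longlonglongrightarrow> 0"
    using tendsto_diff[OF tendsto_const[of "suminf r"] summable_LIMSEQ[OF r_conv]]
    by (simp add: y_def algebra_simps)
  have "Bseq x"
    using x_range by (intro BseqI'[of _ 1]) auto
  have "convergent x"
  proof (rule ccontr)
    assume "\<not> convergent x"
    then obtain p q where pq: "p < q" "\<exists>\<^sub>F n in sequentially. x n < p" "\<exists>\<^sub>F n in sequentially. q < x n"
      using bounded_not_convergent_oscillates[OF \<open>Bseq x\<close>] by blast
    \<comment> \<open>Actual values of \<open>x\<close> beyond both ends place \<open>{p..q}\<close>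
      inside the domain on which \<open>g\<close> is continuous.\<close>
    obtain n m where "x n < p" "q < x m"
      using pq(2,3)[THEN frequently_ex] by blast
    then have "{p..q} \<subseteq> {0..1}"
      using x_range[of n] x_range[of m] by auto
    then obtain a b where ab: "p \<le> a" "a < b" "b \<le> q"
        and sign: "(\<forall>t\<in>{a..b}. 0 \<le> g t) \<or> (\<forall>t\<in>{a..b}. g t \<le> 0)"
      using continuous_constant_sign_subinterval[OF pq(1)] continuous_on_subset[OF g_cont] by metis
    have low: "\<exists>\<^sub>F n in sequentially. x n < a"
      using pq(2) by (rule frequently_elim1) (use ab in simp)
    have high: "\<exists>\<^sub>F n in sequentially. b < x n"
      using pq(3) by (rule frequently_elim1) (use ab in simp)
    from sign show False
    proof
      assume pos: "\<forall>t\<in>{a..b}. 0 \<le> g t"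
      have "y n \<le> y (Suc n)" if "x n \<in> {a..b}" for n
        using mult_nonneg_nonneg[OF theta_nonneg[of n] pos[rule_format, OF that]] y_step[of n] by simp
      then show False by (rule no_oscillation[OF ab(2) close steps _ low high])
    next
      assume neg: "\<forall>t\<in>{a..b}. g t \<le> 0"
      \<comment> \<open>Reflection at 0 reduces the decreasing case to the increasing one;
        \<open>low\<close> and \<open>high\<close> exchange roles.\<close>
      have up: "- y n \<le> - y (Suc n)" if "- x n \<in> {- b..- a}" for n
        using mult_nonneg_nonpos[OF theta_nonneg[of n] neg[rule_format, of "x n"]] y_step[of n] that
        by simp
      show False
      proof (rule no_oscillation[of "- b" "- a" "\<lambda>n. - y n" "\<lambda>n. - x n"])
        show "(\<lambda>n. - y n - - x n) \<longlonglongrightarrow> 0" "(\<lambda>n. - y (Suc n) - - y n) \<longlonglongrightarrow> 0"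
          using tendsto_minus[OF close] tendsto_minus[OF steps] by simp_all
      qed (use ab low high up in simp_all)
    qed
  qed
  then obtain l where l: "x \<longlonglongrightarrow> l" by (auto simp: convergent_def)
  have l_range: "l \<in> {0..1}"
    using closed_sequentially[OF closed_atLeastAtMost x_range l] .
  have "y \<longlonglongrightarrow> l"
    using tendsto_add[OF close l] by simp
  then have y_conv: "convergent y" "convergent (\<lambda>n. - y n)"
    by (auto simp: convergent_def intro: tendsto_minus)
  have g_lim: "(\<lambda>n. g (x n)) \<longlonglongrightarrow> g l"
    using continuous_on_tendsto_compose[OF g_cont l l_range] x_range by simp
  \<comment> \<open>If not, \<open>g (x n)\<close> eventually lies beyond \<open>g l / 2\<close> on
    the same side of 0. The increments of \<open>y\<close>, or of its negative when
    \<open>g l < 0\<close>, then dominate a positive multiple of \<open>\<theta>\<close>.\<close>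
  have "g l = 0"
  proof (rule ccontr)
    assume "g l \<noteq> 0"
    then consider "g l > 0" | "g l < 0" by linarith
    then have "summable \<theta>"
    proof cases
      case 1
      have "\<forall>\<^sub>F n in sequentially. g l / 2 * \<theta> n \<le> y (Suc n) - y n"
        using order_tendstoD(1)[OF g_lim, of "g l / 2"] 1
        by (auto elim!: eventually_mono simp: y_step mult.commute[of _ "\<theta> _"] simp del: times_divide_eq_right
              intro!: mult_left_mono theta_nonneg)
      then show ?thesis
        using summable_if_dominated_by_increments[OF theta_nonneg y_conv(1), of "g l / 2"] 1 by simp
    next
      case 2
      have "\<forall>\<^sub>F n in sequentially. g (x n) < g l / 2"
        using order_tendstoD(2)[OF g_lim, of "g l / 2"] 2 by simp
      then have "\<forall>\<^sub>F n in sequentially. - g l / 2 * \<theta> n \<le> - y (Suc n) - - y n"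
      proof eventually_elim
        case (elim n)
        then have "\<theta> n * g (x n) \<le> \<theta> n * (g l / 2)"
          by (intro mult_left_mono theta_nonneg) simp
        then show ?case using y_step[of n] by (simp add: mult.commute)
      qed
      then show ?thesis
        using summable_if_dominated_by_increments[OF theta_nonneg y_conv(2), of "- g l / 2"] 2 by simp
    qed
    with theta_div show False by contradiction
  qed
  with l l_range show ?thesis by (auto simp: g_def)
qed

end
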